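(* Let $N\ge 1$ and let $f:\{0,\dots,N-1\}\to\{0,\dots,N-1\}$ be a function. Let $(C_0,\dots,C_{\ell-1})$ be the greedy orbit decomposition of $f$. For each $i$ let $v_i$ be the last element of $C_i$. Call $C_i$ a $\rho$-orbit if $f(v_i)\in C_i$; otherwise $f(v_i)\in C_{j(i)}$ for a unique index $j(i)<i$. For each $i$, the number of descents from $C_i$ is the number $d(i)$ of steps in the sequence $i, j(i), j(j(i)),\dots$ until an index $k$ with $C_k$ a $\rho$-orbit is reached (so $d(i)=0$ if $C_i$ is a $\rho$-orbit), and the maximal number of descents of $f$ is $\max_i d(i)$. Then the maximal number of descents of $f$ is at most $\left\lfloor\frac{\sqrt{1+8N}-3}{2}\right\rfloor$.
   Context: The graph of $f$ is the directed graph with vertex set $V=\{0,\dots,N-1\}$ and edges $(x,f(x))$. For a subset $W\subseteq V$, consider the subgraph induced on $W$ (edges $(x,f(x))$ with both $x,f(x)\in W$). In such an induced subgraph, the orbit of a vertex $v$ is the maximal simple directed path $(v,v_1,\dots,v_k)$ starting at $v$ (obtained by following edges until either there is no outgoing edge in the subgraph or the next vertex would repeat one already visited). The greedy orbit decomposition $(C_0,\dots,C_{\ell-1})$ of $f$ is defined as follows: $C_0$ is an orbit of maximal length in the graph of $f$ (among orbits of maximal length, the one whose starting vertex is least); for $k>0$, if $V\ne C_0\cup\dots\cup C_{k-1}$, $C_k$ is an orbit of maximal length in the subgraph induced on $V\setminus(C_0\cup\dots\cup C_{k-1})$ (ties again broken by least starting vertex); $\ell$ is the least $k$ with $V=C_0\cup\dots\cup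 C_{k-1}$. Each $C_i$ is regarded as a sequence ordered along its path, so its last element is well defined. *)

theory Defs
  imports Complex_Main "HOL-Library.FuncSet"
begin

text \<open>The subgraph induced on \<open>W\<close> has the edges \<open>(x, f x)\<close> with \<open>x \<in> W\<close> and \<open>f x \<in> W\<close>;
  a simple directed path in it is the nonempty list of its vertices.\<close>

definition simple_path :: "(nat \<Rightarrow> nat) \<Rightarrow> nat set \<Rightarrow> nat list \<Rightarrow> bool" where
  "simple_path f W p \<longleftrightarrow> p \<noteq> [] \<and> distinct p \<and> set p \<subseteq> W \<and>
     (\<forall>i. Suc i < length p \<longrightarrow> p ! Suc i = f (p ! i))"

text \<open>The orbit of the vertex \<open>hd p\<close> in the subgraph induced on \<open>W\<close>: the path stops because
  its last vertex has no outgoing edge, or because the next vertex has already been visited.\<close>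

definition is_orbit :: "(nat \<Rightarrow> nat) \<Rightarrow> nat set \<Rightarrow> nat list \<Rightarrow> bool" where
  "is_orbit f W p \<longleftrightarrow> simple_path f W p \<and> (f (last p) \<notin> W \<or> f (last p) \<in> set p)"

definition greedy_orbit :: "(nat \<Rightarrow> nat) \<Rightarrow> nat set \<Rightarrow> nat list \<Rightarrow> bool" where
  "greedy_orbit f W p \<longleftrightarrow> is_orbit f W p \<and>
     (\<forall>q. is_orbit f W q \<longrightarrow> length q \<le> length p) \<and>
     (\<forall>q. is_orbit f W q \<and> length q = length p \<longrightarrow> hd p \<le> hd q)"

text \<open>The number of orbits \<open>length Cs\<close> is automatically the least \<open>k\<close> for which the first \<open>k\<close>
  orbits cover \<open>V\<close>, because a greedy orbit in \<open>W\<close> is a nonempty list of elements of \<open>W\<close>.\<close>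

definition greedy_orbit_decomposition :: "(nat \<Rightarrow> nat) \<Rightarrow> nat set \<Rightarrow> nat list list \<Rightarrow> bool" where
  "greedy_orbit_decomposition f V Cs \<longleftrightarrow>
     (\<forall>k<length Cs. greedy_orbit f (V - (\<Union>j<k. set (Cs ! j))) (Cs ! k)) \<and>
     V = (\<Union>j<length Cs. set (Cs ! j))"

definition rho_orbit :: "(nat \<Rightarrow> nat) \<Rightarrow> nat list \<Rightarrow> bool" where
  "rho_orbit f C \<longleftrightarrow> f (last C) \<in> set C"

definition descent_index :: "(nat \<Rightarrow> nat) \<Rightarrow> nat list list \<Rightarrow> nat \<Rightarrow> nat" where
  "descent_index f Cs i = (THE j. j < i \<and> f (last (Cs ! i)) \<in> set (Cs ! j))"

definition num_descents :: "(nat \<Rightarrow> nat) \<Rightarrow> nat list list \<Rightarrow> nat \<Rightarrow> nat" where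
  "num_descents f Cs i = (LEAST n. rho_orbit f (Cs ! ((descent_index f Cs ^^ n) i)))"

definition max_descents :: "(nat \<Rightarrow> nat) \<Rightarrow> nat list list \<Rightarrow> nat" where
  "max_descents f Cs = Max (num_descents f Cs ` {..<length Cs})"


text \<open>Well-definedness of these notions: every finite vertex set has exactly one greedy orbit
  decomposition, the descent index is uniquely determined, and a \<open>\<rho>\<close>-orbit is always reached.\<close>

lemma simple_path_nth:
  assumes "simple_path f W p" "i < length p"
  shows "p ! i = (f ^^ i) (hd p)"
  using assms(2)
proof (induction i)
  case 0
  then show ?case by (simp add: hd_conv_nth)
next
  case (Suc i)
  then show ?case using assms(1) by (simp add: simple_path_def)
qed

lemma simple_path_snoc:
  assumes p: "simple_path f W p" and "f (last p) \<in> W" "f (last p) \<notin> set p"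
  shows "simple_path f W (p @ [f (last p)])"
proof -
  have "(p @ [f (last p)]) ! Suc i = f ((p @ [f (last p)]) ! i)"
    if "Suc i < length (p @ [f (last p)])" for i
  proof (cases "Suc i < length p")
    case True
    then show ?thesis using p by (simp add: simple_path_def nth_append)
  next
    case False
    then have "length p = Suc i" using that by simp
    then show ?thesis by (cases p rule: rev_cases) (auto simp: nth_append)
  qed
  then show ?thesis using assms by (auto simp: simple_path_def)
qed

lemma finite_simple_paths: "finite W \<Longrightarrow> finite {p. simple_path f W p}"
  by (rule finite_subset[OF _ finite_subset_distinct[of W]]) (auto simp: simple_path_def)

lemma ex_is_orbit:
  assumes "finite W" "W \<noteq> {}"
  shows "\<exists>p. is_orbit f W p"
proof -
  let ?S = "{p. simple_path f W p}"
  obtain v where "v \<in> W" using assms by auto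
  then have ne: "[v] \<in> ?S" by (simp add: simple_path_def)
  have fin: "finite (length ` ?S)" using finite_simple_paths[OF assms(1)] by simp
  have "Max (length ` ?S) \<in> length ` ?S" using fin ne by (intro Max_in) auto
  then obtain p where p: "simple_path f W p" "length p = Max (length ` ?S)" by auto
  have "\<not> simple_path f W (p @ [f (last p)])"
  proof
    assume "simple_path f W (p @ [f (last p)])"
    then have "length (p @ [f (last p)]) \<le> Max (length ` ?S)" using fin by (intro Max_ge) blast+
    then show False using p(2) by simp
  qed
  then have "is_orbit f W p" using p(1) simple_path_snoc by (auto simp: is_orbit_def)
  then show ?thesis ..
qed

lemma greedy_orbit_ex:
  assumes "finite W" "W \<noteq> {}"
  shows "\<exists>p. greedy_orbit f W p"
proof -
  let ?S = "{p. is_orbit f W p}"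
  have "finite ?S"
    by (rule finite_subset[OF _ finite_simple_paths[OF assms(1)]]) (auto simp: is_orbit_def)
  then have fin: "finite (length ` ?S)" by simp
  define L where "L = Max (length ` ?S)"
  have "L \<in> length ` ?S" unfolding L_def using fin ex_is_orbit[OF assms] by (intro Max_in) auto
  then obtain p0 where p0: "is_orbit f W p0 \<and> length p0 = L" by auto
  have max: "length q \<le> L" if "is_orbit f W q" for q
    unfolding L_def using fin that by (intro Max_ge) auto
  obtain p where "is_orbit f W p \<and> length p = L"
    "\<And>q. is_orbit f W q \<and> length q = L \<Longrightarrow> hd p \<le> hd q"
    using ex_has_least_nat[of "\<lambda>p. is_orbit f W p \<and> length p = L" p0 hd, OF p0] by blast
  then have "greedy_orbit f W p" using max by (auto simp: greedy_orbit_def)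
  then show ?thesis ..
qed

lemma greedy_orbit_unique:
  assumes p: "greedy_orbit f W p" and q: "greedy_orbit f W q"
  shows "p = q"
proof -
  have len: "length p = length q" using p q by (auto simp: greedy_orbit_def intro: antisym)
  then have "hd p = hd q" using p q by (auto simp: greedy_orbit_def intro: antisym)
  moreover have "simple_path f W p" "simple_path f W q"
    using p q by (auto simp: greedy_orbit_def is_orbit_def)
  ultimately show ?thesis using len by (intro nth_equalityI) (auto simp: simple_path_nth)
qed

lemma greedy_orbit_subset: "greedy_orbit f W p \<Longrightarrow> p \<noteq> [] \<and> set p \<subseteq> W"
  by (simp add: greedy_orbit_def is_orbit_def simple_path_def)

lemma greedy_orbit_decomposition_Nil: "greedy_orbit_decomposition f V [] \<longleftrightarrow> V = {}"
  by (simp add: greedy_orbit_decomposition_def)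

lemma greedy_orbit_decomposition_Cons:
  "greedy_orbit_decomposition f V (C # Cs) \<longleftrightarrow>
     greedy_orbit f V C \<and> greedy_orbit_decomposition f (V - set C) Cs"
proof -
  have U: "(\<Union>j<Suc k. set ((C # Cs) ! j)) = set C \<union> (\<Union>j<k. set (Cs ! j))" for k
    by (simp only: lessThan_Suc_eq_insert_0) auto
  have all: "(\<forall>k<Suc n. P k) \<longleftrightarrow> P 0 \<and> (\<forall>k<n. P (Suc k))" for n and P :: "nat \<Rightarrow> bool"
    using less_Suc_eq_0_disj by auto
  have "greedy_orbit_decomposition f V (C # Cs) \<longleftrightarrow>
      greedy_orbit f V C \<and>
      (\<forall>k<length Cs. greedy_orbit f (V - (set C \<union> (\<Union>j<k. set (Cs ! j)))) (Cs ! k)) \<and>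
      V = set C \<union> (\<Union>j<length Cs. set (Cs ! j))"
    unfolding greedy_orbit_decomposition_def length_Cons all U by simp
  also have "\<dots> \<longleftrightarrow> greedy_orbit f V C \<and>
      (\<forall>k<length Cs. greedy_orbit f (V - set C - (\<Union>j<k. set (Cs ! j))) (Cs ! k)) \<and>
      V - set C = (\<Union>j<length Cs. set (Cs ! j))" (is "?l \<longleftrightarrow> ?r")
  proof
    assume l: ?l
    have "set (Cs ! k) \<inter> set C = {}" if "k < length Cs" for k
      using l that greedy_orbit_subset by blast
    then show ?r using l by (auto simp: Diff_eq Int_assoc)
  next
    assume r: ?r
    then have "set C \<subseteq> V" using greedy_orbit_subset by blast
    then show ?l using r by (auto simp: Diff_eq Int_assoc)
  qed
  finally show ?thesis by (simp add: greedy_orbit_decomposition_def)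
qed

lemma greedy_orbit_decomposition_ex1:
  assumes "finite V"
  shows "\<exists>!Cs. greedy_orbit_decomposition f V Cs"
  using assms
proof (induction "card V" arbitrary: V rule: less_induct)
  case less
  show ?case
  proof (cases "V = {}")
    case True
    have "Cs = []" if "greedy_orbit_decomposition f V Cs" for Cs
      using that True greedy_orbit_subset
      by (cases Cs) (fastforce simp: greedy_orbit_decomposition_Cons)+
    then show ?thesis using True greedy_orbit_decomposition_Nil by blast
  next
    case False
    then obtain C where C: "greedy_orbit f V C" using greedy_orbit_ex less.prems by blast
    have "V - set C \<subset> V" using greedy_orbit_subset[OF C] by (cases C) auto
    then have "card (V - set C) < card V" using less.prems by (intro psubset_card_mono)
    then have ex1: "\<exists>!Cs. greedy_orbit_decomposition f (V - set C) Cs"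
      using less.hyps less.prems by simp
    then obtain Cs where Cs: "greedy_orbit_decomposition f (V - set C) Cs" by blast
    show ?thesis
    proof (rule ex1I)
      show "greedy_orbit_decomposition f V (C # Cs)"
        using C Cs by (simp add: greedy_orbit_decomposition_Cons)
    next
      fix Ds assume Ds: "greedy_orbit_decomposition f V Ds"
      then obtain D Ds' where D: "Ds = D # Ds'"
        using False by (cases Ds) (auto simp: greedy_orbit_decomposition_Nil)
      then have "D = C" using Ds C greedy_orbit_unique
        by (auto simp: greedy_orbit_decomposition_Cons)
      then show "Ds = C # Cs"
        using Ds D Cs ex1 by (auto simp: greedy_orbit_decomposition_Cons)
    qed
  qed
qed

lemma descent_index_ex1:
  assumes f: "f \<in> V \<rightarrow> V" and Cs: "greedy_orbit_decomposition f V Cs"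
    and i: "i < length Cs" and nrho: "\<not> rho_orbit f (Cs ! i)"
  shows "\<exists>!j. j < i \<and> f (last (Cs ! i)) \<in> set (Cs ! j)"
proof -
  let ?W = "\<lambda>k. V - (\<Union>j<k. set (Cs ! j))"
  have g: "greedy_orbit f (?W k) (Cs ! k)" if "k < length Cs" for k
    using Cs that unfolding greedy_orbit_decomposition_def by blast
  have "last (Cs ! i) \<in> V"
    using greedy_orbit_subset[OF g[OF i]] last_in_set by blast
  then have "f (last (Cs ! i)) \<in> V" using f by auto
  moreover have "f (last (Cs ! i)) \<notin> ?W i"
    using g[OF i] nrho by (auto simp: greedy_orbit_def is_orbit_def rho_orbit_def)
  ultimately obtain j where j: "j < i" "f (last (Cs ! i)) \<in> set (Cs ! j)" by blast
  have disj: "set (Cs ! a) \<inter> set (Cs ! b) = {}" if "a < b" "b < i" for a b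
    using greedy_orbit_subset[OF g[of b]] that i by auto
  show ?thesis
  proof (rule ex1I)
    show "j < i \<and> f (last (Cs ! i)) \<in> set (Cs ! j)" using j by blast
  next
    fix k assume "k < i \<and> f (last (Cs ! i)) \<in> set (Cs ! k)"
    then show "k = j" using j disj[of k j] disj[of j k] by (cases k j rule: linorder_cases) auto
  qed
qed

lemma descents_reach_rho_orbit:
  assumes f: "f \<in> V \<rightarrow> V" and Cs: "greedy_orbit_decomposition f V Cs" and i: "i < length Cs"
  shows "\<exists>n. rho_orbit f (Cs ! ((descent_index f Cs ^^ n) i))"
  using i
proof (induction i rule: less_induct)
  case (less i)
  show ?case
  proof (cases "rho_orbit f (Cs ! i)")
    case True
    then show ?thesis by (intro exI[of _ 0]) simp
  next
    case False
    then have lt: "descent_index f Cs i < i"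
      using theI'[OF descent_index_ex1[OF f Cs less.prems False]]
      by (simp add: descent_index_def)
    then obtain n where "rho_orbit f (Cs ! ((descent_index f Cs ^^ n) (descent_index f Cs i)))"
      using less.IH less.prems by (meson less_trans)
    then show ?thesis by (intro exI[of _ "Suc n"]) (simp only: funpow_Suc_right o_apply)
  qed
qed

end

(* If f (last C_i) lies in C_j with j < i, then C_i followed by f (last C_i) is a simple path in the
   vertex set from which C_j was chosen, so maximality of C_j makes C_j strictly longer than C_i.
   Hence a vertex set admitting m descents contains disjoint orbits of lengths at least
   1, ..., m + 1, so (m + 1) (m + 2) <= 2 N. *)
theory Submission
  imports Defs
begin

lemma simple_path_mono: "simple_path f W p \<Longrightarrow> W \<subseteq> W' \<Longrightarrow> simple_path f W' p"
  unfolding simple_path_def by blast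

text \<open>A path that is not yet an orbit can be prolonged by the successor of its last vertex,
  and finiteness of \<open>W\<close> stops this process.\<close>

lemma simple_path_extends_to_orbit:
  assumes "finite W" "simple_path f W p"
  shows "\<exists>q. is_orbit f W q \<and> length p \<le> length q"
  using assms(2)
proof (induction "card W - length p" arbitrary: p rule: less_induct)
  case less
  show ?case
  proof (cases "is_orbit f W p")
    case True
    then show ?thesis by blast
  next
    case False
    then have ext: "simple_path f W (p @ [f (last p)])"
      using less.prems simple_path_snoc by (auto simp: is_orbit_def)
    \<comment> \<open>The measure uses truncated subtraction, so it drops strictly only because the
      longer path still fits into \<open>W\<close>.\<close>
    then have "card (set (p @ [f (last p)])) \<le> card W"
      using assms(1) by (intro card_mono) (auto simp: simple_path_def)
    then have "length (p @ [f (last p)]) \<le> card W"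
      using ext distinct_card[of "p @ [f (last p)]"] unfolding simple_path_def by simp
    then have "card W - length (p @ [f (last p)]) < card W - length p" by simp
    from less.hyps[OF this ext] show ?thesis by fastforce
  qed
qed

text \<open>Greedy maximality compares orbits only. This extends it to all simple paths, since a
  path prolonged by one vertex need not be an orbit.\<close>

lemma length_greedy_orbit_ge:
  assumes "finite W" "greedy_orbit f W C" "simple_path f W p"
  shows "length p \<le> length C"
  using simple_path_extends_to_orbit[OF assms(1,3)] assms(2) order_trans
  unfolding greedy_orbit_def by blast

lemma descent_index_props:
  assumes "f \<in> V \<rightarrow> V" "greedy_orbit_decomposition f V Cs" "i < length Cs"
    and "\<not> rho_orbit f (Cs ! i)"
  shows "descent_index f Cs i < i" "f (last (Cs ! i)) \<in> set (Cs ! descent_index f Cs i)"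
  using theI'[OF descent_index_ex1[OF assms]] by (simp_all add: descent_index_def)

lemma num_descents_rho_orbit: "rho_orbit f (Cs ! i) \<Longrightarrow> num_descents f Cs i = 0"
  by (simp add: num_descents_def)

text \<open>Peeling the first descent off the iteration shifts the \<open>LEAST\<close> by one. This
  recursion lets later proofs induct on the orbit index.\<close>

lemma num_descents_not_rho_orbit:
  assumes "f \<in> V \<rightarrow> V" "greedy_orbit_decomposition f V Cs" "i < length Cs"
    and "\<not> rho_orbit f (Cs ! i)"
  shows "num_descents f Cs i = Suc (num_descents f Cs (descent_index f Cs i))"
proof -
  obtain n where "rho_orbit f (Cs ! ((descent_index f Cs ^^ n) i))"
    using descents_reach_rho_orbit[OF assms(1-3)] by blast
  then show ?thesis
    using Least_Suc[of "\<lambda>n. rho_orbit f (Cs ! ((descent_index f Cs ^^ n) i))" n] assms(4)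
    by (simp add: num_descents_def funpow_Suc_right del: funpow.simps(2))
qed

lemma length_orbit_less_descent:
  assumes "finite V" "f \<in> V \<rightarrow> V" "greedy_orbit_decomposition f V Cs" "i < length Cs"
    and "\<not> rho_orbit f (Cs ! i)"
  shows "length (Cs ! i) < length (Cs ! descent_index f Cs i)"
proof -
  let ?W = "\<lambda>k. V - (\<Union>j<k. set (Cs ! j))"
  let ?j = "descent_index f Cs i" and ?v = "f (last (Cs ! i))"
  note j = descent_index_props[OF assms(2-5)]
  have g: "greedy_orbit f (?W k) (Cs ! k)" if "k < length Cs" for k
    using assms(3) that unfolding greedy_orbit_decomposition_def by blast
  have gj: "greedy_orbit f (?W ?j) (Cs ! ?j)"
    using g j(1) assms(4) by simp
  \<comment> \<open>Fewer vertices were removed at the earlier stage, so \<open>Cs ! i\<close> was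
    already available as a path when \<open>Cs ! ?j\<close> was chosen.\<close>
  have "?W i \<subseteq> ?W ?j" using j(1) by fastforce
  moreover have "simple_path f (?W i) (Cs ! i)"
    using g[OF assms(4)] by (simp only: greedy_orbit_def is_orbit_def)
  ultimately have p: "simple_path f (?W ?j) (Cs ! i)"
    by (rule simple_path_mono[rotated])
  have "?v \<in> ?W ?j" using greedy_orbit_subset[OF gj] j(2) by blast
  moreover have "?v \<notin> set (Cs ! i)" using assms(5) by (simp add: rho_orbit_def)
  ultimately have "simple_path f (?W ?j) (Cs ! i @ [?v])" by (rule simple_path_snoc[OF p])
  from length_greedy_orbit_ge[OF _ gj this] show ?thesis using assms(1) by simp
qed

text \<open>Lengths grow by at least one per descent. Starting at \<open>length (Cs ! i)\<close>
  rather than at 1, and summing only over indices up to \<open>i\<close>, makes the induction go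
  through.\<close>

lemma sum_length_orbits_ge:
  assumes "finite V" "f \<in> V \<rightarrow> V" "greedy_orbit_decomposition f V Cs" "i < length Cs"
  shows "(\<Sum>k\<le>num_descents f Cs i. length (Cs ! i) + k) \<le> (\<Sum>l\<le>i. length (Cs ! l))"
  using assms(4)
proof (induction i rule: less_induct)
  case (less i)
  let ?L = "\<lambda>l. length (Cs ! l)"
  show ?case
  proof (cases "rho_orbit f (Cs ! i)")
    case True
    then show ?thesis using member_le_sum[of i "{..i}" ?L] by (simp add: num_descents_rho_orbit)
  next
    case False
    define j where "j = descent_index f Cs i"
    have j: "j < i" "?L i < ?L j"
      using descent_index_props(1)[OF assms(2,3) less.prems False]
        length_orbit_less_descent[OF assms(1-3) less.prems False] by (simp_all add: j_def)
    have "(\<Sum>k\<le>num_descents f Cs i. ?L i + k) = ?L i + (\<Sum>k\<le>num_descents f Cs j. ?L i + Suc k)"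
      using num_descents_not_rho_orbit[OF assms(2,3) less.prems False]
      by (simp add: sum.atMost_Suc_shift j_def del: sum.atMost_Suc)
    \<comment> \<open>The strict growth \<open>?L i < ?L j\<close> absorbs the shift from
      \<open>k\<close> to \<open>Suc k\<close>.\<close>
    also have "\<dots> \<le> ?L i + (\<Sum>k\<le>num_descents f Cs j. ?L j + k)"
      using j(2) by (intro add_left_mono sum_mono) simp
    also have "\<dots> \<le> ?L i + (\<Sum>l\<le>j. ?L l)"
      using less.IH j(1) less.prems by simp
    also have "\<dots> \<le> ?L i + (\<Sum>l<i. ?L l)"
      using j(1) by (intro add_left_mono sum_mono2) auto
    also have "\<dots> = (\<Sum>l\<le>i. ?L l)" by (simp flip: lessThan_Suc_atMost)
    finally show ?thesis .
  qed
qed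

text \<open>Each orbit lists distinct vertices and is removed before the next is chosen, so the
  lengths count every vertex once.\<close>

lemma sum_length_greedy_orbit_decomposition:
  "finite V \<Longrightarrow> greedy_orbit_decomposition f V Cs \<Longrightarrow> (\<Sum>l<length Cs. length (Cs ! l)) = card V"
proof (induction Cs arbitrary: V)
  case Nil
  then show ?case by (simp add: greedy_orbit_decomposition_Nil)
next
  case (Cons C Cs)
  then have C: "greedy_orbit f V C" and Cs: "greedy_orbit_decomposition f (V - set C) Cs"
    by (simp_all add: greedy_orbit_decomposition_Cons)
  have "set C \<subseteq> V" "length C = card (set C)"
    using C by (simp_all add: greedy_orbit_def is_orbit_def simple_path_def distinct_card)
  moreover have "(\<Sum>l<length Cs. length (Cs ! l)) = card (V - set C)"
    using Cons.IH[OF _ Cs] Cons.prems(1) by simp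
  ultimately show ?case
    using Cons.prems(1) card_mono[of V "set C"]
    by (simp add: sum.lessThan_Suc_shift card_Diff_subset del: sum.lessThan_Suc)
qed

lemma num_descents_bound:
  assumes "finite V" "f \<in> V \<rightarrow> V" "greedy_orbit_decomposition f V Cs" "i < length Cs"
  shows "(num_descents f Cs i + 1) * (num_descents f Cs i + 2) \<le> 2 * card V"
proof -
  let ?d = "num_descents f Cs i"
  have "Cs ! i \<noteq> []"
    using assms(3,4) greedy_orbit_subset unfolding greedy_orbit_decomposition_def by blast
  then have "(\<Sum>k\<le>?d. Suc k) \<le> (\<Sum>k\<le>?d. length (Cs ! i) + k)"
    by (intro sum_mono) (simp add: Suc_le_eq)
  also have "\<dots> \<le> (\<Sum>l\<le>i. length (Cs ! l))" by (rule sum_length_orbits_ge[OF assms])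
  also have "\<dots> \<le> (\<Sum>l<length Cs. length (Cs ! l))"
    using assms(4) by (intro sum_mono2) auto
  also have "\<dots> = card V" by (rule sum_length_greedy_orbit_decomposition[OF assms(1,3)])
  finally have "(\<Sum>k\<le>?d. Suc k) \<le> card V" .
  moreover have "2 * (\<Sum>k\<le>n. Suc k) = (n + 1) * (n + 2)" for n
    by (induction n) (simp_all add: algebra_simps)
  ultimately show ?thesis using mult_le_mono2[of _ "card V" 2] by metis
qed

theorem theorem3p14:
  fixes N :: nat and f :: "nat \<Rightarrow> nat" and Cs :: "nat list list"
  assumes "N \<ge> 1"
    and "f \<in> {0..<N} \<rightarrow> {0..<N}"
    and "greedy_orbit_decomposition f {0..<N} Cs"
  shows "int (max_descents f Cs) \<le> \<lfloor>(sqrt (1 + 8 * real N) - 3) / 2\<rfloor>"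
proof -
  let ?m = "max_descents f Cs"
  \<comment> \<open>Nonemptiness ensures that the \<open>Max\<close> is attained by some
    orbit.\<close>
  have "Cs \<noteq> []" using assms(1,3) by (auto simp: greedy_orbit_decomposition_Nil)
  then have "?m \<in> num_descents f Cs ` {..<length Cs}"
    unfolding max_descents_def by (intro Max_in) auto
  then have "(?m + 1) * (?m + 2) \<le> 2 * N"
    using num_descents_bound[OF _ assms(2,3)] by auto
  then have "real ((?m + 1) * (?m + 2)) \<le> real (2 * N)" by (simp only: of_nat_le_iff)
  \<comment> \<open>Completing the square:
    \<open>(2 * m + 3)^2 = 4 * (m + 1) * (m + 2) + 1\<close>.\<close>
  then have "(2 * real ?m + 3)\<^sup>2 \<le> 1 + 8 * real N"
    by (simp add: power2_eq_square algebra_simps)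
  then have "2 * real ?m + 3 \<le> sqrt (1 + 8 * real N)" by (rule real_le_rsqrt)
  then show ?thesis by (simp add: le_floor_iff)
qed

end
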